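(* Let $l_1,l_2,l_3,l_4>1$ be real numbers. For real $a_1,\dots,a_r$ and real $q>1$ write $S_{a_1a_2\cdots a_r,q}:=\sum_{n=1}^\infty \frac{H_n^{(a_1)}H_n^{(a_2)}\cdots H_n^{(a_r)}}{n^q}$, where $H_n^{(a)}=\sum_{j=1}^n j^{-a}$. Then \[ \zeta(l_1)\zeta(l_2)\zeta(l_3)=S_{l_1l_2,l_3}+S_{l_1l_3,l_2}+S_{l_2l_3,l_1}-S_{l_1,l_2+l_3}-S_{l_2,l_1+l_3}-S_{l_3,l_1+l_2}+\zeta(l_1+l_2+l_3), \] and \begin{align*} \zeta(l_1)\zeta(l_2)\zeta(l_3)\zeta(l_4)=&\,S_{l_1l_2l_3,l_4}+S_{l_1l_2l_4,l_3}+S_{l_1l_3l_4,l_2}+S_{l_2l_3l_4,l_1}\\ &-S_{l_1l_2,l_3+l_4}-S_{l_1l_3,l_2+l_4}-S_{l_1l_4,l_2+l_3}-S_{l_2l_3,l_1+l_4}-S_{l_2l_4,l_1+l_3}-S_{l_3l_4,l_1+l_2}\\ &+S_{l_1,l_2+l_3+l_4}+S_{l_2,l_1+l_3+l_4}+S_{l_3,l_1+l_2+l_4}+S_{l_4,l_1+l_2+l_3}-\zeta(l_1+l_2+l_3+l_4). \end{align*}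
   Context: $\zeta$ is the Riemann zeta function. For real $a>0$ and integer $n\ge1$, $H_n^{(a)}=\sum_{j=1}^n j^{-a}$ is the generalized harmonic number. *)

theory Defs
  imports "HOL-Analysis.Analysis"
begin

(* The Dirichlet series of the Riemann zeta function; it represents zeta(s) for real s > 1,
   and only such arguments are used. The summation index n stands for n + 1. *)
definition zeta :: "real \<Rightarrow> real" where
  "zeta s = (\<Sum>n. 1 / real (Suc n) powr s)"

definition gen_harm :: "real \<Rightarrow> nat \<Rightarrow> real" where
  "gen_harm a n = (\<Sum>j=1..n. real j powr (- a))"

(* euler_sum [a1, ..., ar] q is the sum over n >= 1 of H_n^(a1) ... H_n^(ar) / n^q,
   with the summation index shifted by one. *)
definition euler_sum :: "real list \<Rightarrow> real \<Rightarrow> real" where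
  "euler_sum as q = (\<Sum>n. (\<Prod>a\<leftarrow>as. gen_harm a (Suc n)) / real (Suc n) powr q)"

lemma summable_zeta:
  assumes "s > 1"
  shows "summable (\<lambda>n. 1 / real (Suc n) powr s)"
proof -
  have "summable (\<lambda>n. real (Suc n) powr (- s))"
    using assms by (subst summable_Suc_iff) (simp add: summable_real_powr_iff)
  then show ?thesis
    by (simp add: powr_minus_divide)
qed

lemma gen_harm_nonneg: "gen_harm a n \<ge> 0"
  by (simp add: gen_harm_def sum_nonneg)

lemma gen_harm_le_zeta:
  assumes "a > 1"
  shows "gen_harm a n \<le> zeta a"
proof -
  have "gen_harm a n = (\<Sum>k<n. 1 / real (Suc k) powr a)"
    unfolding gen_harm_def
    by (rule sum.reindex_bij_witness[of _ Suc "\<lambda>j. j - 1"]) (auto simp: powr_minus_divide)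
  also have "\<dots> \<le> zeta a"
    unfolding zeta_def by (rule sum_le_suminf[OF summable_zeta[OF assms]]) auto
  finally show ?thesis .
qed

lemma summable_euler_sum:
  assumes "q > 1" and "\<And>a. a \<in> set as \<Longrightarrow> a > 1"
  shows "summable (\<lambda>n. (\<Prod>a\<leftarrow>as. gen_harm a (Suc n)) / real (Suc n) powr q)"
proof -
  have bound: "0 \<le> (\<Prod>a\<leftarrow>as. gen_harm a n) \<and> (\<Prod>a\<leftarrow>as. gen_harm a n) \<le> (\<Prod>a\<leftarrow>as. zeta a)" for n
    using assms(2)
  proof (induction as)
    case (Cons b as)
    then have "0 \<le> (\<Prod>a\<leftarrow>as. gen_harm a n)"
      and "(\<Prod>a\<leftarrow>as. gen_harm a n) \<le> (\<Prod>a\<leftarrow>as. zeta a)"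
      and "gen_harm b n \<le> zeta b" "0 \<le> gen_harm b n"
      by (auto simp: gen_harm_le_zeta gen_harm_nonneg)
    then show ?case
      by (auto intro!: mult_mono)
  qed simp
  show ?thesis
  proof (rule summable_comparison_test')
    show "summable (\<lambda>n. (\<Prod>a\<leftarrow>as. zeta a) * (1 / real (Suc n) powr q))"
      by (intro summable_mult summable_zeta assms(1))
    show "norm ((\<Prod>a\<leftarrow>as. gen_harm a (Suc n)) / real (Suc n) powr q)
        \<le> (\<Prod>a\<leftarrow>as. zeta a) * (1 / real (Suc n) powr q)" for n
      using bound[of "Suc n"] by (auto intro!: divide_right_mono)
  qed
qed

end

theory Submission
  imports Defs
begin

text \<open>
  The product of the partial sums \<open>H\<^sub>n\<close> tends to the product of the zeta values, so that product
  is the telescoping series of its increments. Writing \<open>H\<^sub>n = H\<^sub>n\<^sub>+\<^sub>1 - (n+1)\<^sup>-\<^sup>l\<close> in each factor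
  and expanding the increment by inclusion-exclusion gives the Euler sums termwise.
\<close>

lemma gen_harm_0 [simp]: "gen_harm a 0 = 0"
  by (simp add: gen_harm_def)

text \<open>The increment is a quotient rather than a negative power so that it agrees with the
  summands of \<open>zeta\<close> and \<open>euler_sum\<close>.\<close>

lemma gen_harm_Suc: "gen_harm a (Suc n) = gen_harm a n + 1 / real (Suc n) powr a"
  by (simp add: gen_harm_def powr_minus_divide)

text \<open>The series for \<open>zeta\<close> runs over \<open>Suc k\<close>, so the indices
  \<open>k < n\<close> match \<open>j = 1..n\<close>: its n-th partial sum is exactly
  \<open>gen_harm a n\<close>, with no shift left over.\<close>

lemma gen_harm_tendsto_zeta:
  assumes "a > 1"
  shows "gen_harm a \<longlonglongrightarrow> zeta a"
proof -
  have "gen_harm a = (\<lambda>n. \<Sum>k<n. 1 / real (Suc k) powr a)"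
  proof
    show "gen_harm a n = (\<Sum>k<n. 1 / real (Suc k) powr a)" for n
      by (induction n) (simp_all add: gen_harm_Suc)
  qed
  then show ?thesis
    using summable_LIMSEQ[OF summable_zeta[OF assms]] by (simp add: zeta_def)
qed

lemma euler_sum_sums:
  assumes "q > 1" and "\<And>a. a \<in> set as \<Longrightarrow> a > 1"
  shows "(\<lambda>n. (\<Prod>a\<leftarrow>as. gen_harm a (Suc n)) / real (Suc n) powr q) sums euler_sum as q"
  unfolding euler_sum_def using summable_euler_sum[OF assms] by (rule summable_sums)

lemma zeta_sums:
  assumes "s > 1"
  shows "(\<lambda>n. 1 / real (Suc n) powr s) sums zeta s"
  unfolding zeta_def using summable_zeta[OF assms] by (rule summable_sums)

lemma zeta_product_3:
  assumes "l1 > 1" and "l2 > 1" and "l3 > 1"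
  shows "zeta l1 * zeta l2 * zeta l3 =
        euler_sum [l1, l2] l3 + euler_sum [l1, l3] l2 + euler_sum [l2, l3] l1
      - euler_sum [l1] (l2 + l3) - euler_sum [l2] (l1 + l3) - euler_sum [l3] (l1 + l2)
      + zeta (l1 + l2 + l3)"
    (is "?L = ?R")
proof -
  let ?F = "\<lambda>n. gen_harm l1 n * gen_harm l2 n * gen_harm l3 n"
  \<comment> \<open>The summands follow the right-hand side term by term, with the list products
    left unevaluated, so that each one has the shape required by \<open>euler_sum_sums\<close> or
    \<open>zeta_sums\<close>.\<close>
  let ?G = "\<lambda>n.
            (\<Prod>a\<leftarrow>[l1, l2]. gen_harm a (Suc n)) / real (Suc n) powr l3
          + (\<Prod>a\<leftarrow>[l1, l3]. gen_harm a (Suc n)) / real (Suc n) powr l2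
          + (\<Prod>a\<leftarrow>[l2, l3]. gen_harm a (Suc n)) / real (Suc n) powr l1
          - (\<Prod>a\<leftarrow>[l1]. gen_harm a (Suc n)) / real (Suc n) powr (l2 + l3)
          - (\<Prod>a\<leftarrow>[l2]. gen_harm a (Suc n)) / real (Suc n) powr (l1 + l3)
          - (\<Prod>a\<leftarrow>[l3]. gen_harm a (Suc n)) / real (Suc n) powr (l1 + l2)
          + 1 / real (Suc n) powr (l1 + l2 + l3)"
  have "?F \<longlonglongrightarrow> ?L"
    using assms by (intro tendsto_mult gen_harm_tendsto_zeta)
  \<comment> \<open>Telescoping yields \<open>?L - ?F 0\<close>, and \<open>?F 0 = 0\<close> because
    the harmonic numbers at index 0 are empty sums.\<close>
  from telescope_sums[OF this] have "(\<lambda>n. ?F (Suc n) - ?F n) sums ?L"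
    by simp
  \<comment> \<open>With A, B, C the harmonic numbers at \<open>Suc n\<close> and x, y, z their last
    terms, this is ABC - (A-x)(B-y)(C-z) = ABz + ACy + BCx - Ayz - Bxz - Cxy + xyz. The minus signs
    arise because the products are taken at \<open>Suc n\<close>; in terms of the values at
    \<open>n\<close> every sign would be plus. \<open>powr_add\<close> splits the combined exponents
    into products of x, y, z.\<close>
  also have "(\<lambda>n. ?F (Suc n) - ?F n) = ?G"
    by (simp add: fun_eq_iff gen_harm_Suc powr_add) (simp add: divide_inverse algebra_simps)
  finally have "?G sums ?L" .
  \<comment> \<open>Termwise splitting is legitimate since each series converges on its own: every
    exponent, being some l or a sum of several, exceeds 1.\<close>
  moreover have "?G sums ?R"
    using assms by (intro sums_add sums_diff euler_sum_sums zeta_sums) auto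
  ultimately show ?thesis
    by (rule sums_unique2)
qed

lemma zeta_product_4:
  assumes "l1 > 1" and "l2 > 1" and "l3 > 1" and "l4 > 1"
  shows "zeta l1 * zeta l2 * zeta l3 * zeta l4 =
        euler_sum [l1, l2, l3] l4 + euler_sum [l1, l2, l4] l3
      + euler_sum [l1, l3, l4] l2 + euler_sum [l2, l3, l4] l1
      - euler_sum [l1, l2] (l3 + l4) - euler_sum [l1, l3] (l2 + l4)
      - euler_sum [l1, l4] (l2 + l3) - euler_sum [l2, l3] (l1 + l4)
      - euler_sum [l2, l4] (l1 + l3) - euler_sum [l3, l4] (l1 + l2)
      + euler_sum [l1] (l2 + l3 + l4) + euler_sum [l2] (l1 + l3 + l4)
      + euler_sum [l3] (l1 + l2 + l4) + euler_sum [l4] (l1 + l2 + l3)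
      - zeta (l1 + l2 + l3 + l4)"
    (is "?L = ?R")
proof -
  let ?F = "\<lambda>n. gen_harm l1 n * gen_harm l2 n * gen_harm l3 n * gen_harm l4 n"
  let ?G = "\<lambda>n.
            (\<Prod>a\<leftarrow>[l1, l2, l3]. gen_harm a (Suc n)) / real (Suc n) powr l4
          + (\<Prod>a\<leftarrow>[l1, l2, l4]. gen_harm a (Suc n)) / real (Suc n) powr l3
          + (\<Prod>a\<leftarrow>[l1, l3, l4]. gen_harm a (Suc n)) / real (Suc n) powr l2
          + (\<Prod>a\<leftarrow>[l2, l3, l4]. gen_harm a (Suc n)) / real (Suc n) powr l1
          - (\<Prod>a\<leftarrow>[l1, l2]. gen_harm a (Suc n)) / real (Suc n) powr (l3 + l4)
          - (\<Prod>a\<leftarrow>[l1, l3]. gen_harm a (Suc n)) / real (Suc n) powr (l2 + l4)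
          - (\<Prod>a\<leftarrow>[l1, l4]. gen_harm a (Suc n)) / real (Suc n) powr (l2 + l3)
          - (\<Prod>a\<leftarrow>[l2, l3]. gen_harm a (Suc n)) / real (Suc n) powr (l1 + l4)
          - (\<Prod>a\<leftarrow>[l2, l4]. gen_harm a (Suc n)) / real (Suc n) powr (l1 + l3)
          - (\<Prod>a\<leftarrow>[l3, l4]. gen_harm a (Suc n)) / real (Suc n) powr (l1 + l2)
          + (\<Prod>a\<leftarrow>[l1]. gen_harm a (Suc n)) / real (Suc n) powr (l2 + l3 + l4)
          + (\<Prod>a\<leftarrow>[l2]. gen_harm a (Suc n)) / real (Suc n) powr (l1 + l3 + l4)
          + (\<Prod>a\<leftarrow>[l3]. gen_harm a (Suc n)) / real (Suc n) powr (l1 + l2 + l4)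
          + (\<Prod>a\<leftarrow>[l4]. gen_harm a (Suc n)) / real (Suc n) powr (l1 + l2 + l3)
          - 1 / real (Suc n) powr (l1 + l2 + l3 + l4)"
  have "?F \<longlonglongrightarrow> ?L"
    using assms by (intro tendsto_mult gen_harm_tendsto_zeta)
  from telescope_sums[OF this] have "(\<lambda>n. ?F (Suc n) - ?F n) sums ?L"
    by simp
  \<comment> \<open>The same expansion with four factors has one term for each of the 15 nonempty
    sets of factors replaced by their last terms. A set of size k has sign (-1)^(k+1), so the pure
    zeta term, with k = 4, is now negative.\<close>
  also have "(\<lambda>n. ?F (Suc n) - ?F n) = ?G"
    by (simp add: fun_eq_iff gen_harm_Suc powr_add) (simp add: divide_inverse algebra_simps)
  finally have "?G sums ?L" .
  moreover have "?G sums ?R"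
    using assms by (intro sums_add sums_diff euler_sum_sums zeta_sums) auto
  ultimately show ?thesis
    by (rule sums_unique2)
qed

theorem theorem3p7:
  fixes l1 l2 l3 l4 :: real
  assumes "l1 > 1" and "l2 > 1" and "l3 > 1" and "l4 > 1"
  shows
    "zeta l1 * zeta l2 * zeta l3 =
        euler_sum [l1, l2] l3 + euler_sum [l1, l3] l2 + euler_sum [l2, l3] l1
      - euler_sum [l1] (l2 + l3) - euler_sum [l2] (l1 + l3) - euler_sum [l3] (l1 + l2)
      + zeta (l1 + l2 + l3)
     \<and>
     zeta l1 * zeta l2 * zeta l3 * zeta l4 =
        euler_sum [l1, l2, l3] l4 + euler_sum [l1, l2, l4] l3
      + euler_sum [l1, l3, l4] l2 + euler_sum [l2, l3, l4] l1
      - euler_sum [l1, l2] (l3 + l4) - euler_sum [l1, l3] (l2 + l4)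
      - euler_sum [l1, l4] (l2 + l3) - euler_sum [l2, l3] (l1 + l4)
      - euler_sum [l2, l4] (l1 + l3) - euler_sum [l3, l4] (l1 + l2)
      + euler_sum [l1] (l2 + l3 + l4) + euler_sum [l2] (l1 + l3 + l4)
      + euler_sum [l3] (l1 + l2 + l4) + euler_sum [l4] (l1 + l2 + l3)
      - zeta (l1 + l2 + l3 + l4)"
  using assms by (intro conjI zeta_product_3 zeta_product_4)

end
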